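(* Let $\mathbb{P}^e$ be an extended multi-adjoint logic program (EMALP) on an extended multi-adjoint lattice with carrier $L$, let $\mathbb{P}^{\tilde e}$ be the corresponding constraint-free EMALP of $\mathbb{P}^e$, let $M^e\colon\Pi_{\mathbb{P}^e}\to L$ be an interpretation, and let $M^{\tilde e}\colon\Pi_{\mathbb{P}^e}\cup\{p_\bot\}\to L$ be the mapping defined by $M^{\tilde e}(p)=M^e(p)$ if $p\in\Pi_{\mathbb{P}^e}$ and $M^{\tilde e}(p_\bot)=\bot$. Then $M^e$ is a stable model of $\mathbb{P}^e$ if and only if $M^{\tilde e}$ is a stable model of $\mathbb{P}^{\tilde e}$.
   Context: Adjoint pair: given a partially ordered set $(P,\leq)$, a pair $(\&,\leftarrow)$ of binary operations on $P$ is an adjoint pair if $\&$ is order-preserving in both arguments; $\leftarrow$ is order-preserving in its first argument (the consequent) and order-reversing in its second argument (the antecedent), i.e. $z\leftarrow y$ is increasing in $z$ and decreasing in $y$; and $x\leq (z\leftarrow y)$ iff $(x\& y)\leq z$ for all $x,y,z\in P$. Multi-adjoint lattice: a tuple $(L,\preceq,\leftarrow_1,\&_1,\dots,\leftarrow_r,\&_r)$ where $(L,\preceq)$ is a bounded lattice with bottom $\bot$ and top $\top$, each $(\&_i,\leftarrow_i)$ is an adjoint pair in $(L,\preceq)$, and $\top\&_i\vartheta=\vartheta\&_i\top=\vartheta$ for all $\vartheta\in L$ and all $i$. Extended aggregator: a mapping $@^e\colon L^n\to L$ on a complete lattice $(L,\preceq)$ which is order-preserving in its first $m$ arguments and order-reversing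 in its last $n-m$ arguments; one writes $@^e[x_1,\dots,x_m;x_{m+1},\dots,x_n]$. An extended multi-adjoint lattice is a multi-adjoint lattice, with $(L,\preceq)$ complete, enriched with a finite family of extended aggregators $@^e_1,\dots,@^e_k$ (arities $n$ and numbers $m$ may depend on the aggregator). EMALP: an extended multi-adjoint logic program $\mathbb{P}^e$ on such a lattice is a finite set of weighted rules $\langle p\leftarrow_i @^e[p_1,\dots,p_m;p_{m+1},\dots,p_n];\vartheta\rangle$ and of constraints $\langle c\leftarrow_i @^e[p_1,\dots,p_m;p_{m+1},\dots,p_n];\top\rangle$, where $i\in\{1,\dots,r\}$, $@^e$ is one of the extended aggregators of the lattice, $\vartheta,c\in L$, and $p,p_1,\dots,p_n$ are propositional symbols with $p_1,\dots,p_n$ pairwise distinct. $\Pi_{\mathbb{P}^e}$ denotes the set of propositional symbols appearing in $\mathbb{P}^e$. It is constraint-free if it contains no constraints. Semantics: an interpretation is a mapping $I$ from the set of propositional symbols of the program to $L$, extended by $I(x)=x$ for $x\in L$. Interpretations are ordered pointwise: $I_1\sqsubseteq I_2$ iff $I_1(p)\preceq I_2(p)$ for all $p$. A rule or constraint $\langle l\leftarrow_i @^e[p_1,\dots,p_m;p_{m+1},\dots,p_n];\vartheta\rangle$ ($l$ a propositional symbol or an element of $L$) is satisfied by $I$ iff $\vartheta\preceq I(l)\leftarrow_i @^e[I(p_1),\dots,I(p_m);I(p_{m+1}),\dots,I(p_n)]$. A model is an interpretation satisfying all rules and constraints. The least model is a model $I$ with $I\sqsubseteq J$ for every model $J$.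 Reduct and stable models: given an interpretation $M$, the reduct of the program with respect to $M$ is obtained by replacing every rule or constraint $\langle l\leftarrow_i @^e[p_1,\dots,p_m;p_{m+1},\dots,p_n];\vartheta\rangle$ by $\langle l\leftarrow_i @^e_M[p_1,\dots,p_m];\vartheta\rangle$, where $@^e_M[\vartheta_1,\dots,\vartheta_m]=@^e[\vartheta_1,\dots,\vartheta_m;M(p_{m+1}),\dots,M(p_n)]$; satisfaction and (least) models of the reduct are defined in the same way, over interpretations with the same domain as $M$. $M$ is a stable model of the program if $M$ is the least model of its reduct with respect to $M$. Corresponding constraint-free EMALP: for $c\in L$ let $f_c\colon L\to L$ be given by $f_c(x)=\bot$ if $x\preceq c$ and $f_c(x)=\top$ otherwise. Let $\mathcal{C}_{\mathbb{P}^e}$ be the set of constraints of $\mathbb{P}^e$, $p_\bot\notin\Pi_{\mathbb{P}^e}$ a new propositional symbol, $\&$ any of the conjunctors $\&_1,\dots,\&_r$ of the lattice, and $\neg\colon L\to L$ any negation operator (an order-reversing mapping with $\neg\bot=\top$ and $\neg\top=\bot$). The corresponding constraint-free EMALP is $$\mathbb{P}^{\tilde e}=(\mathbb{P}^e\setminus\mathcal{C}_{\mathbb{P}^e})\cup\{\langle p_\bot\leftarrow_i f_\bot(\neg p_\bot)\,\&\,f_c(\mathcal{B});\top\rangle\mid\langle c\leftarrow_i\mathcal{B};\top\rangle\in\mathcal{C}_{\mathbb{P}^e}\}.$$ For $\mathcal{B}=@^e[p_1,\dots,p_m;p_{m+1},\dots,p_n]$, the body of the new rule is given by the extended aggregator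 $@^{\tilde e}[p_1,\dots,p_m;p_{m+1},\dots,p_n,p_\bot]=f_\bot(\neg p_\bot)\,\&\,f_c(@^e[p_1,\dots,p_m;p_{m+1},\dots,p_n])$, order-preserving in the first $m$ arguments and order-reversing in the last $n-m+1$; the lattice is enriched with these aggregators. Interpretations of $\mathbb{P}^{\tilde e}$ are mappings $\Pi_{\mathbb{P}^e}\cup\{p_\bot\}\to L$. *)

theory Defs
  imports Main "HOL-Library.FuncSet"
begin

definition adjoint_pair :: "('l::order \<Rightarrow> 'l \<Rightarrow> 'l) \<Rightarrow> ('l \<Rightarrow> 'l \<Rightarrow> 'l) \<Rightarrow> bool" where
  "adjoint_pair cnj imp \<longleftrightarrow>
     (\<forall>y. mono (\<lambda>x. cnj x y)) \<and> (\<forall>x. mono (\<lambda>y. cnj x y)) \<and>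
     (\<forall>y. mono (\<lambda>z. imp z y)) \<and> (\<forall>z. antimono (\<lambda>y. imp z y)) \<and>
     (\<forall>x y z. x \<le> imp z y \<longleftrightarrow> cnj x y \<le> z)"

text \<open>
  A mapping \<open>@[x\<^sub>1,\<dots>,x\<^sub>m; x\<^sub>m\<^sub>+\<^sub>1,\<dots>,x\<^sub>n]\<close> is given by the numbers \<open>m\<close> (\<open>npos\<close>) and
  \<open>n - m\<close> (\<open>nneg\<close>) and a function (\<open>app\<close>) of the two argument lists separated by the
  semicolon; values of \<open>app\<close> on lists of other lengths are never used.
\<close>

datatype 'l aggregator =
  Aggregator (npos: nat) (nneg: nat) (app: "'l list \<Rightarrow> 'l list \<Rightarrow> 'l")

definition extended_aggregator :: "'l::order aggregator \<Rightarrow> bool" where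
  "extended_aggregator a \<longleftrightarrow>
     (\<forall>xs ys. length xs = npos a \<and> length ys = nneg a \<longrightarrow>
        (\<forall>i<npos a. mono (\<lambda>x. app a (xs[i := x]) ys)) \<and>
        (\<forall>i<nneg a. antimono (\<lambda>y. app a xs (ys[i := y]))))"

text \<open>
  The carrier and its order are those of the type \<open>'l\<close>. The adjoint pairs are indexed by
  \<open>1, \<dots>, npairs\<close>; values of \<open>conjunctor\<close> and \<open>implication\<close> at other indices are irrelevant.
\<close>

record 'l ema_lattice =
  npairs :: nat
  conjunctor :: "nat \<Rightarrow> 'l \<Rightarrow> 'l \<Rightarrow> 'l"
  implication :: "nat \<Rightarrow> 'l \<Rightarrow> 'l \<Rightarrow> 'l"
  aggregators :: "'l aggregator set"

definition multi_adjoint_lattice :: "'l::bounded_lattice ema_lattice \<Rightarrow> bool" where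
  "multi_adjoint_lattice L \<longleftrightarrow>
     (\<forall>i\<in>{1..npairs L}. adjoint_pair (conjunctor L i) (implication L i) \<and>
        (\<forall>t. conjunctor L i top t = t \<and> conjunctor L i t top = t))"

definition extended_multi_adjoint_lattice :: "'l::complete_lattice ema_lattice \<Rightarrow> bool" where
  "extended_multi_adjoint_lattice L \<longleftrightarrow>
     multi_adjoint_lattice L \<and> finite (aggregators L) \<and>
     (\<forall>a\<in>aggregators L. extended_aggregator a)"

datatype ('a, 'l) head = Sym 'a | Val 'l

text \<open>
  \<open>Clause l i a ps ns t\<close> stands for the weighted rule or constraint
  \<open>\<langle>l \<leftarrow>\<^sub>i a[ps; ns]; t\<rangle>\<close>: a rule if \<open>l\<close> is a propositional symbol, a constraint if \<open>l\<close>
  is an element of the lattice.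
\<close>

datatype ('a, 'l) clause =
  Clause (clause_head: "('a, 'l) head") (clause_imp: nat) (clause_agg: "'l aggregator")
    (clause_pos: "'a list") (clause_neg: "'a list") (clause_weight: 'l)

definition is_constraint :: "('a, 'l) clause \<Rightarrow> bool" where
  "is_constraint s \<longleftrightarrow> (\<exists>c. clause_head s = Val c)"

definition constraints :: "('a, 'l) clause set \<Rightarrow> ('a, 'l) clause set" where
  "constraints P = {s \<in> P. is_constraint s}"

definition constraint_free :: "('a, 'l) clause set \<Rightarrow> bool" where
  "constraint_free P \<longleftrightarrow> constraints P = {}"

definition wf_clause :: "'l::complete_lattice ema_lattice \<Rightarrow> ('a, 'l) clause \<Rightarrow> bool" where
  "wf_clause L s \<longleftrightarrow>
     clause_imp s \<in> {1..npairs L} \<and> clause_agg s \<in> aggregators L \<and>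
     length (clause_pos s) = npos (clause_agg s) \<and>
     length (clause_neg s) = nneg (clause_agg s) \<and>
     distinct (clause_pos s @ clause_neg s) \<and>
     (is_constraint s \<longrightarrow> clause_weight s = top)"

definition emalp :: "'l::complete_lattice ema_lattice \<Rightarrow> ('a, 'l) clause set \<Rightarrow> bool" where
  "emalp L P \<longleftrightarrow> finite P \<and> (\<forall>s\<in>P. wf_clause L s)"

definition symbols :: "('a, 'l) clause set \<Rightarrow> 'a set" where
  "symbols P = (\<Union>s\<in>P. {p. clause_head s = Sym p} \<union> set (clause_pos s) \<union> set (clause_neg s))"

text \<open>
  An interpretation with domain \<open>D\<close> is a function that is \<open>undefined\<close> outside \<open>D\<close>.
\<close>

definition interpretations :: "'a set \<Rightarrow> ('a \<Rightarrow> 'l) set" where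
  "interpretations D = D \<rightarrow>\<^sub>E UNIV"

definition interp_le :: "'a set \<Rightarrow> ('a \<Rightarrow> 'l::order) \<Rightarrow> ('a \<Rightarrow> 'l) \<Rightarrow> bool" where
  "interp_le D I J \<longleftrightarrow> (\<forall>p\<in>D. I p \<le> J p)"

fun head_value :: "('a \<Rightarrow> 'l) \<Rightarrow> ('a, 'l) head \<Rightarrow> 'l" where
  "head_value I (Sym p) = I p"
| "head_value I (Val c) = c"

definition satisfies ::
  "'l::complete_lattice ema_lattice \<Rightarrow> ('a \<Rightarrow> 'l) \<Rightarrow> ('a, 'l) clause \<Rightarrow> bool" where
  "satisfies L I s \<longleftrightarrow>
     clause_weight s \<le>
       implication L (clause_imp s) (head_value I (clause_head s))
         (app (clause_agg s) (map I (clause_pos s)) (map I (clause_neg s)))"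

definition is_model ::
  "'l::complete_lattice ema_lattice \<Rightarrow> 'a set \<Rightarrow> ('a, 'l) clause set \<Rightarrow> ('a \<Rightarrow> 'l) \<Rightarrow> bool" where
  "is_model L D P I \<longleftrightarrow> I \<in> interpretations D \<and> (\<forall>s\<in>P. satisfies L I s)"

definition is_least_model ::
  "'l::complete_lattice ema_lattice \<Rightarrow> 'a set \<Rightarrow> ('a, 'l) clause set \<Rightarrow> ('a \<Rightarrow> 'l) \<Rightarrow> bool" where
  "is_least_model L D P I \<longleftrightarrow>
     is_model L D P I \<and> (\<forall>J. is_model L D P J \<longrightarrow> interp_le D I J)"

definition reduct_aggregator :: "('a \<Rightarrow> 'l) \<Rightarrow> 'l aggregator \<Rightarrow> 'a list \<Rightarrow> 'l aggregator" where
  "reduct_aggregator M a ns = Aggregator (npos a) 0 (\<lambda>xs ys. app a xs (map M ns))"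

fun reduct_clause :: "('a \<Rightarrow> 'l) \<Rightarrow> ('a, 'l) clause \<Rightarrow> ('a, 'l) clause" where
  "reduct_clause M (Clause l i a ps ns t) = Clause l i (reduct_aggregator M a ns) ps [] t"

definition reduct :: "('a \<Rightarrow> 'l) \<Rightarrow> ('a, 'l) clause set \<Rightarrow> ('a, 'l) clause set" where
  "reduct M P = reduct_clause M ` P"

text \<open>
  The domain \<open>D\<close> of the interpretations is a parameter because it can be strictly larger than
  \<open>symbols P\<close>, and \<open>symbols (reduct M P)\<close> can be strictly smaller than \<open>symbols P\<close>.
\<close>

definition stable_model ::
  "'l::complete_lattice ema_lattice \<Rightarrow> 'a set \<Rightarrow> ('a, 'l) clause set \<Rightarrow> ('a \<Rightarrow> 'l) \<Rightarrow> bool" where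
  "stable_model L D P M \<longleftrightarrow> M \<in> interpretations D \<and> is_least_model L D (reduct M P) M"

definition negation_operator :: "('l::bounded_lattice \<Rightarrow> 'l) \<Rightarrow> bool" where
  "negation_operator ng \<longleftrightarrow> antimono ng \<and> ng bot = top \<and> ng top = bot"

definition threshold :: "'l::bounded_lattice \<Rightarrow> 'l \<Rightarrow> 'l" where
  "threshold c x = (if x \<le> c then bot else top)"

text \<open>
  The last element of the second argument list is the value of the new symbol.
\<close>

definition constraint_aggregator ::
  "('l::bounded_lattice \<Rightarrow> 'l \<Rightarrow> 'l) \<Rightarrow> ('l \<Rightarrow> 'l) \<Rightarrow> 'l \<Rightarrow> 'l aggregator \<Rightarrow> 'l aggregator" where
  "constraint_aggregator cnj ng c a =
     Aggregator (npos a) (nneg a + 1)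
       (\<lambda>xs ys. cnj (threshold bot (ng (last ys))) (threshold c (app a xs (butlast ys))))"

text \<open>
  In the next two definitions \<open>k\<close> is the index of the conjunctor used in the new bodies.
\<close>

definition enrich ::
  "'l::complete_lattice ema_lattice \<Rightarrow> ('a, 'l) clause set \<Rightarrow> nat \<Rightarrow> ('l \<Rightarrow> 'l) \<Rightarrow> 'l ema_lattice"
  where
  "enrich L P k ng =
     L\<lparr>aggregators := aggregators L \<union>
         {constraint_aggregator (conjunctor L k) ng c a | c i a ps ns.
            Clause (Val c) i a ps ns top \<in> constraints P}\<rparr>"

definition corresponding_constraint_free ::
  "'l::complete_lattice ema_lattice \<Rightarrow> ('a, 'l) clause set \<Rightarrow> nat \<Rightarrow> ('l \<Rightarrow> 'l) \<Rightarrow> 'a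
     \<Rightarrow> ('a, 'l) clause set" where
  "corresponding_constraint_free L P k ng pbot =
     (P - constraints P) \<union>
     {Clause (Sym pbot) i (constraint_aggregator (conjunctor L k) ng c a) ps (ns @ [pbot]) top
        | c i a ps ns. Clause (Val c) i a ps ns top \<in> constraints P}"

definition extend_bot :: "'a set \<Rightarrow> 'a \<Rightarrow> ('a \<Rightarrow> 'l::bounded_lattice) \<Rightarrow> 'a \<Rightarrow> 'l" where
  "extend_bot D pbot M = (\<lambda>p\<in>insert pbot D. if p \<in> D then M p else bot)"

lemma threshold_mono: "mono (threshold c)"
  by (auto simp: mono_def threshold_def intro: order_trans)

lemma extended_aggregator_constraint_aggregator:
  assumes "adjoint_pair cnj imp" "negation_operator ng" "extended_aggregator a"
  shows "extended_aggregator (constraint_aggregator cnj ng c a)"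
proof -
  have cm: "cnj x y \<le> cnj x' y'" if "x \<le> x'" "y \<le> y'" for x x' y y'
    using assms(1) that unfolding adjoint_pair_def mono_def by (meson order_trans)
  note tm = monoD[OF threshold_mono]
  have nm: "ng y \<le> ng x" if "x \<le> y" for x y
    using assms(2) that by (auto simp: negation_operator_def antimono_def)
  have pos: "app a (xs[i := x]) ys \<le> app a (xs[i := x']) ys"
    if "length xs = npos a" "length ys = nneg a" "i < npos a" "x \<le> x'" for xs ys i x x'
    using assms(3) that by (auto simp: extended_aggregator_def mono_def)
  have neg: "app a xs (ys[i := y']) \<le> app a xs (ys[i := y])"
    if "length xs = npos a" "length ys = nneg a" "i < nneg a" "y \<le> y'" for xs ys i y y'
    using assms(3) that by (auto simp: extended_aggregator_def antimono_def)
  show ?thesis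
    unfolding extended_aggregator_def constraint_aggregator_def
  proof (intro allI impI conjI, goal_cases)
    case (1 xs ys i)
    then show ?case by (auto intro!: monoI cm tm pos)
  next
    case (2 xs ys i)
    then have len: "length ys = Suc (nneg a)" "length xs = npos a" "i < Suc (nneg a)" by auto
    show ?case
    proof (rule antimonoI)
      fix y y' :: 'a assume le: "y \<le> y'"
      have "last (ys[i := y]) \<le> last (ys[i := y'])"
        using len le by (cases "ys = []") (auto simp: last_list_update)
      moreover have "app a xs (butlast (ys[i := y'])) \<le> app a xs (butlast (ys[i := y]))"
        using len le neg[of xs "butlast ys" i y y'] by (auto simp: butlast_list_update)
      ultimately show "app (Aggregator (npos a) (nneg a + 1) (\<lambda>xs ys. cnj (threshold bot (ng (last ys)))
            (threshold c (app a xs (butlast ys))))) xs (ys[i := y'])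
          \<le> app (Aggregator (npos a) (nneg a + 1) (\<lambda>xs ys. cnj (threshold bot (ng (last ys)))
            (threshold c (app a xs (butlast ys))))) xs (ys[i := y])"
        by (auto intro!: cm tm nm)
    qed
  qed
qed

lemma extended_multi_adjoint_lattice_enrich:
  assumes "extended_multi_adjoint_lattice L" "emalp L P" "k \<in> {1..npairs L}"
    "negation_operator ng"
  shows "extended_multi_adjoint_lattice (enrich L P k ng)"
proof -
  let ?N = "{constraint_aggregator (conjunctor L k) ng c a | c i a ps ns.
            Clause (Val c) i a ps ns top \<in> constraints P}"
  have "?N \<subseteq> (\<lambda>s. case s of Clause (Val c) i a ps ns t \<Rightarrow>
      constraint_aggregator (conjunctor L k) ng c a) ` P"
    by (force simp: constraints_def)
  then have fin: "finite ?N"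
    using assms(2) by (auto simp: emalp_def intro: finite_surj)
  have "extended_aggregator b" if "b \<in> ?N" for b
  proof -
    from that obtain c i a ps ns where b: "b = constraint_aggregator (conjunctor L k) ng c a"
      and P: "Clause (Val c) i a ps ns top \<in> P" by (auto simp: constraints_def)
    have "a \<in> aggregators L" using assms(2) P by (auto simp: emalp_def wf_clause_def)
    then show ?thesis
      using assms unfolding b
      by (auto simp: extended_multi_adjoint_lattice_def multi_adjoint_lattice_def
          intro!: extended_aggregator_constraint_aggregator[of _ "implication L k"])
  qed
  then have "\<forall>a\<in>aggregators L \<union> ?N. extended_aggregator a"
    using assms(1) unfolding extended_multi_adjoint_lattice_def by blast
  moreover have "finite (aggregators L \<union> ?N)"
    using fin assms(1) unfolding extended_multi_adjoint_lattice_def by blast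
  moreover have "multi_adjoint_lattice (enrich L P k ng)"
    using assms(1)
    by (simp add: extended_multi_adjoint_lattice_def multi_adjoint_lattice_def enrich_def)
  moreover have "aggregators (enrich L P k ng) = aggregators L \<union> ?N"
    by (simp add: enrich_def)
  ultimately show ?thesis
    unfolding extended_multi_adjoint_lattice_def by metis
qed

lemma emalp_corresponding_constraint_free:
  assumes "emalp L P" "pbot \<notin> symbols P"
  shows "emalp (enrich L P k ng) (corresponding_constraint_free L P k ng pbot)"
proof -
  let ?N = "{Clause (Sym pbot) i (constraint_aggregator (conjunctor L k) ng c a) ps (ns @ [pbot]) top
        | c i a ps ns. Clause (Val c) i a ps ns top \<in> constraints P}"
  have "?N \<subseteq> (\<lambda>s. case s of Clause (Val c) i a ps ns t \<Rightarrow>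
      Clause (Sym pbot) i (constraint_aggregator (conjunctor L k) ng c a) ps (ns @ [pbot]) top) ` P"
    by (force simp: constraints_def)
  then have "finite ?N"
    using assms(1) by (auto simp: emalp_def intro: finite_surj)
  moreover have "wf_clause (enrich L P k ng) s" if "s \<in> P" for s
    using assms(1) that by (auto simp: emalp_def wf_clause_def enrich_def)
  moreover have "wf_clause (enrich L P k ng) s" if sN: "s \<in> ?N" for s
  proof -
    from sN obtain c i a ps ns where
      s: "s = Clause (Sym pbot) i (constraint_aggregator (conjunctor L k) ng c a) ps (ns @ [pbot]) top"
      and P: "Clause (Val c) i a ps ns top \<in> constraints P" by auto
    have "pbot \<notin> set ps" "pbot \<notin> set ns"
      using assms(2) P by (force simp: symbols_def constraints_def)+
    moreover have "wf_clause L (Clause (Val c) i a ps ns top)"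
      using assms(1) P by (auto simp: emalp_def constraints_def)
    moreover have "constraint_aggregator (conjunctor L k) ng c a \<in> aggregators (enrich L P k ng)"
      using P unfolding enrich_def by auto
    ultimately show ?thesis
      unfolding s by (auto simp: wf_clause_def is_constraint_def enrich_def constraint_aggregator_def)
  qed
  ultimately show ?thesis
    using assms(1) unfolding emalp_def corresponding_constraint_free_def by blast
qed

lemma constraint_free_corresponding:
  "constraint_free (corresponding_constraint_free L P k ng pbot)"
  by (auto simp: constraint_free_def constraints_def corresponding_constraint_free_def
      is_constraint_def)

end

theory Submission
  imports Defs
begin

text \<open>
  With \<open>p\<^sub>\<bottom>\<close> at \<open>\<bottom>\<close>, the reduct of a new rule says exactly that the constraint it comes from
  holds, so \<open>M\<close> and its extension satisfy corresponding reducts. For minimality, models of the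
  reduct of \<open>P\<close> extend by \<open>\<bottom>\<close> to models of the reduct of the constraint-free program. Conversely,
  a model \<open>J\<close> of the latter may violate the constraints of \<open>P\<close>, but the meet of \<open>J\<close> with \<open>M\<close>
  does not: reduct bodies are monotone, so the meet inherits the constraints from \<open>M\<close> and
  the rules from both. Hence \<open>M\<close> lies below the meet, and so below \<open>J\<close>.
\<close>

text \<open>The definition gives monotonicity in one argument at a time; raising the entries one
  after another makes it joint.\<close>

lemma extended_aggregator_mono_pos:
  assumes "extended_aggregator a" "length xs = npos a" "length ys = nneg a"
    and "list_all2 (\<le>) xs xs'"
  shows "app a xs ys \<le> app a xs' ys"
proof -
  have len: "length xs' = length xs"
    using assms(4) by (simp add: list_all2_lengthD)
  \<comment> \<open>The intermediate lists agree with \<open>xs'\<close> on the first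
    \<open>j\<close> places and with \<open>xs\<close> afterwards. Two consecutive ones are updates
    of the same list at place \<open>j\<close>, so monotonicity in that single argument compares
    them.\<close>
  have "app a xs ys \<le> app a (take j xs' @ drop j xs) ys" if "j \<le> length xs" for j
    using that
  proof (induction j)
    case 0
    then show ?case by simp
  next
    case (Suc j)
    let ?zs = "take j xs' @ drop j xs"
    have j: "j < length xs" using Suc.prems by simp
    have "?zs[j := xs ! j] = ?zs"
      using j len by (simp add: list_update_append Cons_nth_drop_Suc[symmetric])
    moreover have "?zs[j := xs' ! j] = take (Suc j) xs' @ drop (Suc j) xs"
      using j len
      by (simp add: list_update_append Cons_nth_drop_Suc[symmetric] take_Suc_conv_app_nth)
    moreover have "mono (\<lambda>x. app a (?zs[j := x]) ys)"
      using assms(1-3) j len by (auto simp: extended_aggregator_def)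
    moreover have "xs ! j \<le> xs' ! j"
      using assms(4) j by (simp add: list_all2_nthD)
    ultimately have "app a ?zs ys \<le> app a (take (Suc j) xs' @ drop (Suc j) xs) ys"
      by (metis (no_types, lifting) monoD)
    then show ?case using Suc by (meson Suc_leD order_trans)
  qed
  from this[of "length xs"] show ?thesis using len by simp
qed

lemma conjunctor_mono:
  assumes "multi_adjoint_lattice L" "i \<in> {1..npairs L}" "x \<le> x'" "y \<le> y'"
  shows "conjunctor L i x y \<le> conjunctor L i x' y'"
proof -
  have "mono (\<lambda>x. conjunctor L i x y)" "mono (conjunctor L i x')"
    using assms(1,2) by (auto simp: multi_adjoint_lattice_def adjoint_pair_def)
  then show ?thesis using assms(3,4) by (blast dest: monoD intro: order_trans)
qed

lemma conjunctor_top: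
  assumes "multi_adjoint_lattice L" "i \<in> {1..npairs L}"
  shows "conjunctor L i top x = x" "conjunctor L i x top = x"
  using assms by (auto simp: multi_adjoint_lattice_def)

text \<open>Adjointness trades the implication for the conjunctor, leaving an inequality between
  body and head in which \<open>J\<close> enters only through the positive symbols and the
  head.\<close>

lemma satisfies_reduct_clause_iff:
  assumes "multi_adjoint_lattice L" "i \<in> {1..npairs L}"
  shows "satisfies L J (reduct_clause M (Clause l i a ps ns t)) \<longleftrightarrow>
    conjunctor L i t (app a (map J ps) (map M ns)) \<le> head_value J l"
proof -
  have "x \<le> implication L i z y \<longleftrightarrow> conjunctor L i x y \<le> z" for x y z
    using assms unfolding multi_adjoint_lattice_def adjoint_pair_def by blast
  then show ?thesis
    by (simp add: satisfies_def reduct_aggregator_def)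
qed

text \<open>This allows interpretations to be extended to \<open>pbot\<close> or cut down to a
  domain without affecting the clauses of \<open>P\<close>.\<close>

lemma satisfies_reduct_clause_cong:
  assumes "\<And>p. p \<in> symbols {s} \<Longrightarrow> J p = J' p" "\<And>p. p \<in> symbols {s} \<Longrightarrow> M p = M' p"
  shows "satisfies L J (reduct_clause M s) \<longleftrightarrow> satisfies L J' (reduct_clause M' s)"
proof (cases s)
  case (Clause l i a ps ns t)
  have "map J ps = map J' ps" "map M ns = map M' ns" "head_value J l = head_value J' l"
    using assms by (cases l; auto simp: Clause symbols_def)+
  then show ?thesis
    unfolding Clause satisfies_def reduct_clause.simps reduct_aggregator_def clause.sel aggregator.sel
    by (simp only:)
qed

lemma symbols_mono: "P \<subseteq> Q \<Longrightarrow> symbols P \<subseteq> symbols Q"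
  unfolding symbols_def by blast

text \<open>The order-reversing arguments are frozen at \<open>M\<close>, so only the
  order-preserving ones vary.\<close>

lemma reduct_body_mono:
  assumes "extended_multi_adjoint_lattice L" "wf_clause L (Clause l i a ps ns t)"
    and "\<And>p. p \<in> set ps \<Longrightarrow> I p \<le> J p"
  shows "app a (map I ps) (map M ns) \<le> app a (map J ps) (map M ns)"
  using assms
  by (intro extended_aggregator_mono_pos)
    (auto simp: extended_multi_adjoint_lattice_def wf_clause_def list_all2_conv_all_nth)

text \<open>The body at the meet lies below the bodies at \<open>I\<close> and at \<open>J\<close>,
  hence below \<open>I q\<close> and \<open>J q\<close>, hence below their meet.\<close>

lemma satisfies_reduct_clause_inf:
  assumes L: "extended_multi_adjoint_lattice L" and wf: "wf_clause L (Clause (Sym q) i a ps ns t)"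
    and I: "satisfies L I (reduct_clause M (Clause (Sym q) i a ps ns t))"
    and J: "satisfies L J (reduct_clause M (Clause (Sym q) i a ps ns t))"
  shows "satisfies L (\<lambda>p. inf (I p) (J p)) (reduct_clause M (Clause (Sym q) i a ps ns t))"
proof -
  let ?body = "\<lambda>I. conjunctor L i t (app a (map I ps) (map M ns))"
  have mal: "multi_adjoint_lattice L" and i: "i \<in> {1..npairs L}"
    using L wf by (auto simp: extended_multi_adjoint_lattice_def wf_clause_def)
  have "?body (\<lambda>p. inf (I p) (J p)) \<le> ?body I" "?body (\<lambda>p. inf (I p) (J p)) \<le> ?body J"
    by (intro conjunctor_mono[OF mal i] order_refl reduct_body_mono[OF L wf]; simp)+
  then show ?thesis
    using I J unfolding satisfies_reduct_clause_iff[OF mal i] head_value.simps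
    by (meson le_inf_iff order_trans)
qed

lemma threshold_le_bot_iff: "threshold c x \<le> bot \<longleftrightarrow> x \<le> c"
proof (cases "x \<le> c")
  case False
  \<comment> \<open>If \<open>top\<close> were below \<open>bot\<close>, then \<open>x\<close> would
    be below \<open>c\<close>; a one-element lattice therefore never reaches this case.\<close>
  have "x \<le> top" "bot \<le> c" by simp_all
  then have "\<not> top \<le> (bot :: 'a)" using False by (meson order_trans)
  then show ?thesis using False by (simp add: threshold_def)
qed (simp add: threshold_def)

text \<open>Since \<open>M pbot = bot\<close>, the guard \<open>threshold bot (ng bot)\<close> is
  \<open>top\<close>. Both this guard and the weight \<open>top\<close> are neutral for their
  conjunctors, so only the threshold of the old body remains.\<close>

lemma satisfies_reduct_new_rule_iff:
  assumes "multi_adjoint_lattice L" "i \<in> {1..npairs L}" "k \<in> {1..npairs L}"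
    and "negation_operator ng" "M pbot = bot"
  shows "satisfies L J (reduct_clause M
      (Clause (Sym pbot) i (constraint_aggregator (conjunctor L k) ng c a) ps (ns @ [pbot]) top))
    \<longleftrightarrow> threshold c (app a (map J ps) (map M ns)) \<le> J pbot"
proof -
  \<comment> \<open>If \<open>top \<le> bot\<close>, the threshold returns \<open>bot\<close>, but
    then \<open>bot\<close> and \<open>top\<close> coincide.\<close>
  have "threshold bot (ng bot) = top"
    using assms(4) unfolding negation_operator_def threshold_def by (metis top_le)
  then show ?thesis
    unfolding satisfies_reduct_clause_iff[OF assms(1,2)]
    by (simp add: constraint_aggregator_def assms(5) conjunctor_top[OF assms(1,2)]
        conjunctor_top[OF assms(1,3)])
qed

lemma satisfies_enrich [simp]: "satisfies (enrich L P k ng) I s \<longleftrightarrow> satisfies L I s"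
  by (simp add: satisfies_def enrich_def)

lemma is_model_reduct_iff:
  assumes L: "extended_multi_adjoint_lattice L" and P: "emalp L P"
  shows "is_model L D (reduct M P) J \<longleftrightarrow> J \<in> interpretations D \<and>
    (\<forall>s\<in>P - constraints P. satisfies L J (reduct_clause M s)) \<and>
    (\<forall>c i a ps ns. Clause (Val c) i a ps ns top \<in> constraints P \<longrightarrow>
      app a (map J ps) (map M ns) \<le> c)"
proof -
  have "(\<forall>s\<in>constraints P. satisfies L J (reduct_clause M s)) \<longleftrightarrow>
    (\<forall>c i a ps ns. Clause (Val c) i a ps ns top \<in> constraints P \<longrightarrow>
      app a (map J ps) (map M ns) \<le> c)" (is "?l \<longleftrightarrow> ?r")
  proof -
    have *: "satisfies L J (reduct_clause M (Clause (Val c) i a ps ns top)) \<longleftrightarrow>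
        app a (map J ps) (map M ns) \<le> c" if "Clause (Val c) i a ps ns top \<in> constraints P"
      for c i a ps ns
    proof -
      have "multi_adjoint_lattice L" "i \<in> {1..npairs L}"
        using L P that
        by (auto simp: extended_multi_adjoint_lattice_def emalp_def constraints_def wf_clause_def)
      then show ?thesis
        by (subst satisfies_reduct_clause_iff) (auto simp: conjunctor_top)
    qed
    \<comment> \<open>Well-formedness forces the weight \<open>top\<close>, so the clauses of this
      shape are all the constraints.\<close>
    have "\<exists>c i a ps ns. s = Clause (Val c) i a ps ns top" if "s \<in> constraints P" for s
      using P that by (cases s) (auto simp: constraints_def emalp_def wf_clause_def is_constraint_def)
    then show ?thesis using * by metis
  qed
  moreover have "P = (P - constraints P) \<union> constraints P" by (auto simp: constraints_def)
  ultimately show ?thesis unfolding is_model_def reduct_def by blast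
qed

text \<open>As \<open>pbot\<close> does not occur in \<open>P\<close>, the old rules have the same
  reduct meaning under \<open>M\<close> and its extension. The characterization thus shares its rule
  condition with \<open>is_model_reduct_iff\<close>; the two differ in the domain and in how
  constraints appear.\<close>

lemma is_model_reduct_corresponding_iff:
  assumes L: "extended_multi_adjoint_lattice L" and P: "emalp L P"
    and k: "k \<in> {1..npairs L}" and ng: "negation_operator ng" and pbot: "pbot \<notin> symbols P"
  shows "is_model (enrich L P k ng) D
      (reduct (extend_bot (symbols P) pbot M) (corresponding_constraint_free L P k ng pbot)) J \<longleftrightarrow>
    J \<in> interpretations D \<and>
    (\<forall>s\<in>P - constraints P. satisfies L J (reduct_clause M s)) \<and>
    (\<forall>c i a ps ns. Clause (Val c) i a ps ns top \<in> constraints P \<longrightarrow>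
      threshold c (app a (map J ps) (map M ns)) \<le> J pbot)"
proof -
  let ?M = "extend_bot (symbols P) pbot M"
  have M: "?M p = M p" if "p \<in> symbols P" for p
    using that by (simp add: extend_bot_def)
  have Mbot: "?M pbot = bot" using pbot by (simp add: extend_bot_def)
  have rule: "satisfies L J (reduct_clause ?M s) \<longleftrightarrow> satisfies L J (reduct_clause M s)"
    if "s \<in> P" for s
    using that symbols_mono[of "{s}" P] by (intro satisfies_reduct_clause_cong) (auto simp: M)
  have new: "satisfies L J (reduct_clause ?M
      (Clause (Sym pbot) i (constraint_aggregator (conjunctor L k) ng c a) ps (ns @ [pbot]) top))
    \<longleftrightarrow> threshold c (app a (map J ps) (map M ns)) \<le> J pbot"
    if "Clause (Val c) i a ps ns top \<in> constraints P" for c i a ps ns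
  proof -
    have "multi_adjoint_lattice L" "i \<in> {1..npairs L}"
      using L P that
      by (auto simp: extended_multi_adjoint_lattice_def emalp_def constraints_def wf_clause_def)
    moreover have "map ?M ns = map M ns"
      using that M by (force simp: constraints_def symbols_def)
    ultimately show ?thesis
      using satisfies_reduct_new_rule_iff[where M = ?M, OF _ _ k ng Mbot] by metis
  qed
  show ?thesis
    unfolding is_model_def reduct_def corresponding_constraint_free_def satisfies_enrich
    using rule new by blast
qed

theorem theorem18:
  fixes L :: "'l::complete_lattice ema_lattice"
    and P :: "('a, 'l) clause set"
    and k :: nat
    and ng :: "'l \<Rightarrow> 'l"
    and pbot :: 'a
    and M :: "'a \<Rightarrow> 'l"
  assumes "extended_multi_adjoint_lattice L"
    and "emalp L P"
    and "k \<in> {1..npairs L}"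
    and "negation_operator ng"
    and "pbot \<notin> symbols P"
    and "M \<in> interpretations (symbols P)"
  shows "stable_model L (symbols P) P M \<longleftrightarrow>
    stable_model (enrich L P k ng) (insert pbot (symbols P))
      (corresponding_constraint_free L P k ng pbot) (extend_bot (symbols P) pbot M)"
proof -
  let ?D = "symbols P" and ?E = "extend_bot (symbols P) pbot"
  let ?rules = "\<lambda>J. \<forall>s\<in>P - constraints P. satisfies L J (reduct_clause M s)"
  let ?model = "is_model L ?D (reduct M P)"
  let ?model' = "is_model (enrich L P k ng) (insert pbot ?D)
    (reduct (?E M) (corresponding_constraint_free L P k ng pbot))"
  note model = is_model_reduct_iff[OF assms(1,2)]
  note model' = is_model_reduct_corresponding_iff[OF assms(1-5)]
  have rules_cong: "?rules I \<longleftrightarrow> ?rules J" if "\<And>p. p \<in> ?D \<Longrightarrow> I p = J p" for I J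
  proof -
    have "satisfies L I (reduct_clause M s) \<longleftrightarrow> satisfies L J (reduct_clause M s)" if "s \<in> P" for s
      using that \<open>\<And>p. p \<in> ?D \<Longrightarrow> I p = J p\<close> symbols_mono[of "{s}" P]
      by (intro satisfies_reduct_clause_cong) auto
    then show ?thesis by blast
  qed
  have set_pos: "set ps \<subseteq> ?D" if "Clause l i a ps ns t \<in> constraints P" for l i a ps ns t
    using that by (force simp: constraints_def symbols_def)
  have E: "?E I p = I p" if "p \<in> ?D" for p and I :: "'a \<Rightarrow> 'l"
    using that by (simp add: extend_bot_def)
  have E_interp: "?E I \<in> interpretations (insert pbot ?D)" for I :: "'a \<Rightarrow> 'l"
    by (auto simp: interpretations_def extend_bot_def)
  \<comment> \<open>At \<open>pbot\<close> the extension has value \<open>bot\<close>, and a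
    threshold is below \<open>bot\<close> exactly when the constraint body is below
    \<open>c\<close>.\<close>
  have model_E: "?model' (?E I) \<longleftrightarrow> ?model I" if I: "I \<in> interpretations ?D" for I
  proof -
    have "?E I pbot = bot" using assms(5) by (simp add: extend_bot_def)
    moreover have "?rules (?E I) \<longleftrightarrow> ?rules I" by (rule rules_cong) (rule E)
    moreover have "app a (map (?E I) ps) (map M ns) \<le> c \<longleftrightarrow> app a (map I ps) (map M ns) \<le> c"
      if "Clause (Val c) i a ps ns top \<in> constraints P" for c i a ps ns
    proof -
      have "map (?E I) ps = map I ps" using set_pos[OF that] E by auto
      then show ?thesis by metis
    qed
    ultimately show ?thesis
      unfolding model model' using I E_interp by (simp add: threshold_le_bot_iff cong: imp_cong)
  qed
  have least: "(\<forall>J. ?model J \<longrightarrow> interp_le ?D M J) \<longleftrightarrow>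
      (\<forall>J. ?model' J \<longrightarrow> interp_le (insert pbot ?D) (?E M) J)" if M: "?model M"
  proof safe
    fix J assume least: "\<forall>J. ?model J \<longrightarrow> interp_le ?D M J" and J: "?model' J"
    let ?K = "\<lambda>p. inf (M p) (J p)"
    have wf: "wf_clause L s" if "s \<in> P" for s using assms(2) that by (simp add: emalp_def)
    have "satisfies L ?K (reduct_clause M s)" if s: "s \<in> P - constraints P" for s
    proof -
      obtain q i a ps ns t where s_eq: "s = Clause (Sym q) i a ps ns t"
        using s by (cases s; cases "clause_head s") (auto simp: constraints_def is_constraint_def)
      have "satisfies L M (reduct_clause M s)" "satisfies L J (reduct_clause M s)" "wf_clause L s"
        using M J s wf unfolding model model' by blast+
      then show ?thesis
        unfolding s_eq by (intro satisfies_reduct_clause_inf[OF assms(1), where I = M and J = J])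
    qed
    then have "?rules ?K" by blast
    \<comment> \<open>The meet need not be \<open>undefined\<close> outside \<open>?D\<close>, so it
      must be restricted to count as an interpretation with domain \<open>?D\<close>.\<close>
    moreover have "?rules (restrict ?K ?D) \<longleftrightarrow> ?rules ?K" by (rule rules_cong) simp
    moreover have "app a (map (restrict ?K ?D) ps) (map M ns) \<le> c"
      if c: "Clause (Val c) i a ps ns top \<in> constraints P" for c i a ps ns
    proof -
      have "wf_clause L (Clause (Val c) i a ps ns top)" using c wf by (auto simp: constraints_def)
      then have "app a (map (restrict ?K ?D) ps) (map M ns) \<le> app a (map M ps) (map M ns)"
        using set_pos[OF c] by (intro reduct_body_mono[OF assms(1)]) auto
      also have "\<dots> \<le> c" using M c unfolding model by blast
      finally show ?thesis .
    qed
    ultimately have "?model (restrict ?K ?D)"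
      unfolding model by (auto simp: interpretations_def)
    with least have "interp_le ?D M (restrict ?K ?D)" by blast
    \<comment> \<open>On \<open>?D\<close> the meet is below \<open>J\<close>; at
      \<open>pbot\<close> the left side is \<open>bot\<close>.\<close>
    then show "interp_le (insert pbot ?D) (?E M) J"
      using assms(5) by (auto simp: interp_le_def extend_bot_def)
  next
    fix J assume least: "\<forall>J. ?model' J \<longrightarrow> interp_le (insert pbot ?D) (?E M) J" and J: "?model J"
    then have "?model' (?E J)" using model_E by (auto simp: is_model_def)
    with least have "interp_le (insert pbot ?D) (?E M) (?E J)" by blast
    then show "interp_le ?D M J" by (auto simp: interp_le_def E)
  qed
  show ?thesis
    unfolding stable_model_def is_least_model_def
    using assms(6) E_interp model_E[OF assms(6)] least by blast
qed

end
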